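(* Let $a<b$, let $n\ge 0$ be an integer, and let $g_0,\dots,g_n:[a,b]\to\mathbb{R}$ be continuous functions forming a Chebyshev system on $[a,b]$. Let $S_1,\dots,S_m:[a,b]\to\mathbb{R}$ ($m\ge 1$) be continuous, and put $S_{\max}(t)=\max_{1\le i\le m}S_i(t)$ and $S_{\min}(t)=\min_{1\le i\le m}S_i(t)$. For $\mathbf{A}=(a_0,\dots,a_n)\in\mathbb{R}^{n+1}$ let $S(\mathbf{A},t)=\sum_{i=0}^n a_i g_i(t)$ and $$F(\mathbf{A})=\max_{t\in[a,b]}\max\{S_{\max}(t)-S(\mathbf{A},t),\ S(\mathbf{A},t)-S_{\min}(t)\}.$$ Let $\mathbf{A}^*\in\mathbb{R}^{n+1}$ and $\Delta=F(\mathbf{A}^* )$. Then $S(\mathbf{A}^*,\cdot)$ is a best approximation to the pair of curves $S_{\max}$, $S_{\min}$ on $[a,b]$ (that is, $F(\mathbf{A}^* )\le F(\mathbf{A})$ for all $\mathbf{A}\in\mathbb{R}^{n+1}$) if and only if at least one of the following conditions holds: 1. there exists $\tau\in[a,b]$ such that $\Delta=S_{\max}(\tau)-S(\mathbf{A}^*,\tau)=S(\mathbf{A}^*,\tau)-S_{\min}(\tau)$; 2. there exist $n+2$ points $a\le t_1<t_2<\dots<t_{n+2}\le b$ which are alternately positive and negative maximal deviation points, i.e. either - $S_{\max}(t_k)-S(\mathbf{A}^*,t_k)=\Delta$ for all odd $k\in\{1,\dots,n+2\}$ and $S(\mathbf{A}^*,t_k)-S_{\min}(t_k)=\Delta$ for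 all even $k\in\{1,\dots,n+2\}$, or - $S(\mathbf{A}^*,t_k)-S_{\min}(t_k)=\Delta$ for all odd $k\in\{1,\dots,n+2\}$ and $S_{\max}(t_k)-S(\mathbf{A}^*,t_k)=\Delta$ for all even $k\in\{1,\dots,n+2\}$.
   Context: Functions $g_0,\dots,g_n$ form a Chebyshev system on $[a,b]$ if the $(n+1)\times(n+1)$ determinant $\det\big(g_i(t_j)\big)_{0\le i\le n,\ 1\le j\le n+1}$ is nonzero for every choice of points $a\le t_1<\dots<t_{n+1}\le b$. With $\Delta=F(\mathbf{A}^* )$, a point $t$ with $S_{\max}(t)-S(\mathbf{A}^*,t)=\Delta$ is called a positive maximal deviation point, and a point $t$ with $S(\mathbf{A}^*,t)-S_{\min}(t)=\Delta$ a negative maximal deviation point. *)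

theory Defs
  imports Complex_Main "Jordan_Normal_Form.Determinant"
begin

text \<open>
  Functions on \<open>[a,b]\<close> are total functions \<open>real \<Rightarrow> real\<close> used only on \<open>{a..b}\<close>.
  A parameter vector in \<open>\<real>\<^sup>n\<^sup>+\<^sup>1\<close> is a function \<open>A :: nat \<Rightarrow> real\<close> of which only the
  values \<open>A 0, \<dots>, A n\<close> are used; the points \<open>t\<^sub>1 < \<dots> < t\<^sub>N\<close> are a function
  \<open>t :: nat \<Rightarrow> real\<close> restricted to \<open>{1..N}\<close>.
\<close>

text \<open>Matrix indices start at 0, so column \<open>j\<close> belongs to the point \<open>t (j + 1)\<close>.\<close>

definition chebyshev_system :: "nat \<Rightarrow> (nat \<Rightarrow> real \<Rightarrow> real) \<Rightarrow> real \<Rightarrow> real \<Rightarrow> bool" where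
  "chebyshev_system n g a b \<longleftrightarrow>
     (\<forall>t :: nat \<Rightarrow> real. strict_mono_on {1..n+1} t \<and> (\<forall>j\<in>{1..n+1}. t j \<in> {a..b}) \<longrightarrow>
        Determinant.det (Matrix.mat (n+1) (n+1) (\<lambda>(i, j). g i (t (j+1)))) \<noteq> 0)"

definition S_max :: "nat \<Rightarrow> (nat \<Rightarrow> real \<Rightarrow> real) \<Rightarrow> real \<Rightarrow> real" where
  "S_max m S t = Max ((\<lambda>i. S i t) ` {1..m})"

definition S_min :: "nat \<Rightarrow> (nat \<Rightarrow> real \<Rightarrow> real) \<Rightarrow> real \<Rightarrow> real" where
  "S_min m S t = Min ((\<lambda>i. S i t) ` {1..m})"

definition lin_comb :: "nat \<Rightarrow> (nat \<Rightarrow> real \<Rightarrow> real) \<Rightarrow> (nat \<Rightarrow> real) \<Rightarrow> real \<Rightarrow> real" where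
  "lin_comb n g A t = (\<Sum>i=0..n. A i * g i t)"

text \<open>The supremum is a maximum for continuous data; see \<open>max_deviation_attained\<close>.\<close>

definition max_deviation ::
  "real \<Rightarrow> real \<Rightarrow> nat \<Rightarrow> (nat \<Rightarrow> real \<Rightarrow> real) \<Rightarrow> nat \<Rightarrow> (nat \<Rightarrow> real \<Rightarrow> real) \<Rightarrow> (nat \<Rightarrow> real) \<Rightarrow> real"
where
  "max_deviation a b m S n g A =
     (SUP t\<in>{a..b}. max (S_max m S t - lin_comb n g A t) (lin_comb n g A t - S_min m S t))"

definition best_approximation ::
  "real \<Rightarrow> real \<Rightarrow> nat \<Rightarrow> (nat \<Rightarrow> real \<Rightarrow> real) \<Rightarrow> nat \<Rightarrow> (nat \<Rightarrow> real \<Rightarrow> real) \<Rightarrow> (nat \<Rightarrow> real) \<Rightarrow> bool"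
where
  "best_approximation a b m S n g A \<longleftrightarrow>
     (\<forall>B :: nat \<Rightarrow> real. max_deviation a b m S n g A \<le> max_deviation a b m S n g B)"

definition pos_max_dev_point ::
  "real \<Rightarrow> real \<Rightarrow> nat \<Rightarrow> (nat \<Rightarrow> real \<Rightarrow> real) \<Rightarrow> nat \<Rightarrow> (nat \<Rightarrow> real \<Rightarrow> real) \<Rightarrow> (nat \<Rightarrow> real) \<Rightarrow> real \<Rightarrow> bool"
where
  "pos_max_dev_point a b m S n g A t \<longleftrightarrow>
     t \<in> {a..b} \<and> S_max m S t - lin_comb n g A t = max_deviation a b m S n g A"

definition neg_max_dev_point ::
  "real \<Rightarrow> real \<Rightarrow> nat \<Rightarrow> (nat \<Rightarrow> real \<Rightarrow> real) \<Rightarrow> nat \<Rightarrow> (nat \<Rightarrow> real \<Rightarrow> real) \<Rightarrow> (nat \<Rightarrow> real) \<Rightarrow> real \<Rightarrow> bool"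
where
  "neg_max_dev_point a b m S n g A t \<longleftrightarrow>
     t \<in> {a..b} \<and> lin_comb n g A t - S_min m S t = max_deviation a b m S n g A"

lemma continuous_on_Max_image:
  fixes f :: "'i \<Rightarrow> real \<Rightarrow> real"
  assumes "finite I" "I \<noteq> {}" "\<And>i. i \<in> I \<Longrightarrow> continuous_on X (f i)"
  shows "continuous_on X (\<lambda>t. Max ((\<lambda>i. f i t) ` I))"
  using assms
proof (induction I rule: finite_ne_induct)
  case (singleton x)
  then show ?case by simp
next
  case (insert x F)
  have "(\<lambda>t. Max ((\<lambda>i. f i t) ` insert x F)) = (\<lambda>t. max (f x t) (Max ((\<lambda>i. f i t) ` F)))"
    using insert.hyps by simp
  then show ?case
    using insert by (auto intro!: continuous_on_max)
qed

lemma continuous_on_Min_image: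
  fixes f :: "'i \<Rightarrow> real \<Rightarrow> real"
  assumes "finite I" "I \<noteq> {}" "\<And>i. i \<in> I \<Longrightarrow> continuous_on X (f i)"
  shows "continuous_on X (\<lambda>t. Min ((\<lambda>i. f i t) ` I))"
  using assms
proof (induction I rule: finite_ne_induct)
  case (singleton x)
  then show ?case by simp
next
  case (insert x F)
  have "(\<lambda>t. Min ((\<lambda>i. f i t) ` insert x F)) = (\<lambda>t. min (f x t) (Min ((\<lambda>i. f i t) ` F)))"
    using insert.hyps by simp
  then show ?case
    using insert by (auto intro!: continuous_on_min)
qed

lemma max_deviation_attained:
  assumes "a \<le> b" "m \<ge> 1"
    and "\<And>i. i \<in> {0..n} \<Longrightarrow> continuous_on {a..b} (g i)"
    and "\<And>i. i \<in> {1..m} \<Longrightarrow> continuous_on {a..b} (S i)"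
  defines "d \<equiv> \<lambda>A t. max (S_max m S t - lin_comb n g A t) (lin_comb n g A t - S_min m S t)"
  shows "\<exists>t\<in>{a..b}. max_deviation a b m S n g A = d A t \<and> (\<forall>s\<in>{a..b}. d A s \<le> d A t)"
proof -
  have "continuous_on {a..b} (S_max m S)" "continuous_on {a..b} (S_min m S)"
    unfolding S_max_def S_min_def using assms(2,4)
    by (auto intro!: continuous_on_Max_image continuous_on_Min_image)
  moreover have "continuous_on {a..b} (lin_comb n g A)"
    unfolding lin_comb_def using assms(3) by (auto intro!: continuous_intros)
  ultimately have "continuous_on {a..b} (d A)"
    unfolding d_def by (intro continuous_on_max continuous_on_diff)
  then obtain t where t: "t \<in> {a..b}" "\<forall>s\<in>{a..b}. d A s \<le> d A t"
    using continuous_attains_sup[of "{a..b}" "d A"] assms(1) compact_Icc by fastforce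
  have "Sup (d A ` {a..b}) = d A t"
    using t by (intro cSup_eq_maximum) auto
  then show ?thesis
    using t unfolding max_deviation_def d_def by auto
qed

end

theory Submission
  imports Defs "HOL-Analysis.Elementary_Metric_Spaces"
begin

text \<open>
  Sufficiency: at a point of condition 1 the two deviations of any competitor add up to \<open>2\<Delta>\<close>, and
  under condition 2 the difference of a strictly better competitor and \<open>S(A\<^sup>*,\<cdot>)\<close> would change sign
  \<open>n + 1\<close> times, hence have \<open>n + 1\<close> zeros.

  Necessity: if condition 1 fails, the sets \<open>E\<close> and \<open>F\<close> of positive and negative maximal deviation
  points are compact and disjoint, and if condition 2 fails too, at most \<open>n\<close> switches between them
  occur from left to right. A combination with simple zeros at the switches, obtained as a limit of
  combinations having their remaining zeros clustered at \<open>b\<close>, has weakly the right signs on \<open>E\<close> and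
  \<open>F\<close>. Adding a small multiple of a combination that interpolates the right signs at its at most \<open>n\<close>
  zeros makes the signs strict, and moving \<open>A\<^sup>*\<close> in that direction lowers the maximal deviation.
\<close>

subsection \<open>Finite node sets and real functions\<close>

lemma strict_mono_enumeration_real:
  fixes Z :: "real set"
  assumes "finite Z"
  obtains t :: "nat \<Rightarrow> real" where "strict_mono_on {1..card Z} t" "t ` {1..card Z} = Z"
proof -
  define xs where "xs = sorted_list_of_set Z"
  have xs: "sorted_wrt (<) xs" "set xs = Z" "length xs = card Z"
    using assms by (auto simp: xs_def)
  define t where "t k = xs ! (k - 1)" for k
  have "strict_mono_on {1..card Z} t"
    using sorted_wrt_nth_less[OF xs(1)] xs(3)
    by (auto simp: strict_mono_on_def t_def)
  moreover have "t ` {1..card Z} = Z"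
  proof -
    have "t ` {1..card Z} = (\<lambda>i. xs ! i) ` {..<length xs}"
    proof -
      have "{1..card Z} = Suc ` {..<length xs}"
        by (simp add: xs(3) lessThan_atLeast0 atLeastLessThanSuc_atLeastAtMost)
      then show ?thesis
        by (simp add: t_def image_image)
    qed
    also have "\<dots> = Z"
      using xs(2) by (auto simp: in_set_conv_nth)
    finally show ?thesis .
  qed
  ultimately show ?thesis
    using that by blast
qed

lemma strict_mono_onI_Suc:
  fixes t :: "nat \<Rightarrow> real"
  assumes "\<And>k. 1 \<le> k \<Longrightarrow> k < N \<Longrightarrow> t k < t (Suc k)"
  shows "strict_mono_on {1..N} t"
proof (rule strict_mono_onI)
  fix r s assume "r \<in> {1..N}" "s \<in> {1..N}" "r < s"
  then have "1 \<le> r" "s \<le> N" by auto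
  from \<open>r < s\<close> \<open>1 \<le> r\<close> \<open>s \<le> N\<close> show "t r < t s"
  proof (induction s)
    case (Suc s)
    then show ?case
      using assms[of s] by (cases "r = s") auto
  qed simp
qed

text \<open>Open intervals are infinite, so there is room for fillers off \<open>Z\<close>.
  Interpolation uses this to reach \<open>n + 1\<close> nodes, the limit argument to place surplus
  zeros arbitrarily close to \<open>b\<close>.\<close>

lemma extend_node_set:
  fixes Z :: "real set"
  assumes "finite Z" "card Z \<le> k" "x < y"
  obtains Y where "finite Y" "Z \<subseteq> Y" "Y - Z \<subseteq> {x<..<y}" "card Y = k"
proof -
  have "infinite ({x<..<y} - Z)"
    by (rule Diff_infinite_finite[OF assms(1) infinite_Ioo[OF assms(3)]])
  then obtain X where X: "finite X" "card X = k - card Z" "X \<subseteq> {x<..<y} - Z"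
    using infinite_arbitrarily_large by blast
  have "card (Z \<union> X) = k"
    using X assms by (subst card_Un_disjoint) auto
  then show ?thesis
    using that[of "Z \<union> X"] X assms by auto
qed

lemma card_less_split:
  fixes Z :: "real set"
  assumes "finite Z" "x < y" "x \<notin> Z" "y \<notin> Z"
  shows "card {z\<in>Z. z < y} = card {z\<in>Z. z < x} + card (Z \<inter> {x..y})"
proof -
  have "{z\<in>Z. z < y} = {z\<in>Z. z < x} \<union> (Z \<inter> {x..y})"
    using assms(2-4) by (auto simp: order_less_le)
  moreover have "{z\<in>Z. z < x} \<inter> (Z \<inter> {x..y}) = {}" by auto
  ultimately show ?thesis
    using assms(1) by (simp add: card_Un_disjoint)
qed

text \<open>On the compact part of \<open>K\<close> where \<open>h\<close> is nonpositive,
  \<open>f\<close> has a positive minimum, so a large \<open>c\<close> makes it dominate; elsewhere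
  \<open>h\<close> alone suffices. The eventual form lets one \<open>c\<close> serve several
  inequalities.\<close>

lemma eventually_scaled_sum_pos:
  fixes f h :: "real \<Rightarrow> real"
  assumes "compact K" "continuous_on K f" "continuous_on K h"
    and nonneg: "\<And>x. x \<in> K \<Longrightarrow> 0 \<le> f x" and pos: "\<And>x. x \<in> K \<Longrightarrow> f x = 0 \<Longrightarrow> 0 < h x"
  shows "\<forall>\<^sub>F c in at_top. \<forall>x\<in>K. 0 < c * f x + h x"
proof -
  define L where "L = {x\<in>K. h x \<le> 0}"
  have "compact L"
  proof -
    have "closed L"
      unfolding L_def using assms(1,3)
      by (intro continuous_on_closed_Collect_le) (auto simp: compact_imp_closed)
    then have "compact (K \<inter> L)" using assms(1) by (rule compact_Int_closed[rotated])
    also have "K \<inter> L = L" by (auto simp: L_def)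
    finally show ?thesis .
  qed
  show ?thesis
  proof (cases "L = {}")
    case True
    then have "\<forall>x\<in>K. 0 < c * f x + h x" if "c \<ge> 0" for c
      using that nonneg by (auto simp: L_def not_le intro!: add_nonneg_pos)
    then show ?thesis
      by (rule eventually_at_top_linorderI)
  next
    case False
    have contL: "continuous_on L f" "continuous_on L h"
      using assms(2,3) by (auto simp: L_def intro: continuous_on_subset)
    obtain y where y: "y \<in> L" "\<forall>x\<in>L. f y \<le> f x"
      using continuous_attains_inf[OF \<open>compact L\<close> False contL(1)] by metis
    obtain z where z: "z \<in> L" "\<forall>x\<in>L. h z \<le> h x"
      using continuous_attains_inf[OF \<open>compact L\<close> False contL(2)] by metis
    have "y \<in> K" "h y \<le> 0" using y(1) by (auto simp: L_def)
    then have "f y \<ge> 0" "f y \<noteq> 0" using nonneg[of y] pos[of y] by auto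
    then have "f y > 0" by simp
    \<comment> \<open>The threshold makes \<open>c * f y\<close> at least \<open>1 - h z\<close>, so
      the sum is at least 1 on \<open>L\<close>; it is nonnegative because
      \<open>h z \<le> 0\<close>.\<close>
    have "\<forall>x\<in>K. 0 < c * f x + h x" if c: "c \<ge> (1 - h z) / f y" for c
    proof
      fix x assume "x \<in> K"
      have "c \<ge> 0"
      proof -
        have "0 \<le> (1 - h z) / f y"
          using \<open>f y > 0\<close> z(1) by (auto simp: L_def)
        with c show ?thesis by simp
      qed
      show "0 < c * f x + h x"
      proof (cases "x \<in> L")
        case True
        have "1 - h z \<le> c * f y"
          using c \<open>f y > 0\<close> by (simp add: pos_divide_le_eq)
        also have "\<dots> \<le> c * f x"
          using y(2) True \<open>c \<ge> 0\<close> by (simp add: mult_left_mono)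
        finally show ?thesis
          using z(2) True by fastforce
      next
        case False
        then show ?thesis
          using \<open>x \<in> K\<close> \<open>c \<ge> 0\<close> nonneg by (auto simp: L_def not_le intro!: add_nonneg_pos)
      qed
    qed
    then show ?thesis
      by (rule eventually_at_top_linorderI)
  qed
qed

text \<open>Bolzano-Weierstrass coordinate by coordinate: each further coordinate costs one more
  subsequence. Coefficient vectors are functions of which only the values up to \<open>n\<close>
  count, hence the coordinatewise form.\<close>

lemma bounded_sequences_convergent_subseq:
  fixes B :: "nat \<Rightarrow> nat \<Rightarrow> real"
  assumes "\<And>i j. i \<le> n \<Longrightarrow> \<bar>B j i\<bar> \<le> M"
  shows "\<exists>r L. strict_mono (r :: nat \<Rightarrow> nat) \<and> (\<forall>i\<le>n. (\<lambda>j. B (r j) i) \<longlonglongrightarrow> L i)"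
proof -
  have sub: "\<exists>s l. strict_mono (s :: nat \<Rightarrow> nat) \<and> (\<lambda>j. X (s j)) \<longlonglongrightarrow> l"
    if "\<And>j. \<bar>X j\<bar> \<le> M" for X :: "nat \<Rightarrow> real"
  proof -
    obtain s where s: "strict_mono (s :: nat \<Rightarrow> nat)" "monoseq (\<lambda>j. X (s j))"
      using seq_monosub by blast
    have "Bseq (\<lambda>j. X (s j))"
      using that by (intro BseqI'[of _ M]) auto
    then show ?thesis
      using s Bseq_monoseq_convergent by (auto simp: convergent_def)
  qed
  show ?thesis
    using assms
  proof (induction n)
    case 0
    then obtain s l where "strict_mono (s :: nat \<Rightarrow> nat)" "(\<lambda>j. B (s j) 0) \<longlonglongrightarrow> l"
      using sub[of "\<lambda>j. B j 0"] by auto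
    then show ?case
      by (intro exI[of _ s] exI[of _ "\<lambda>_. l"]) auto
  next
    case (Suc n)
    then obtain r L where r: "strict_mono (r :: nat \<Rightarrow> nat)"
      and L: "\<And>i. i \<le> n \<Longrightarrow> (\<lambda>j. B (r j) i) \<longlonglongrightarrow> L i"
      by (metis le_SucI)
    obtain s l where s: "strict_mono (s :: nat \<Rightarrow> nat)"
      and l: "(\<lambda>j. B (r (s j)) (Suc n)) \<longlonglongrightarrow> l"
      using sub[of "\<lambda>j. B (r j) (Suc n)"] Suc.prems by auto
    have "(\<lambda>j. B ((r \<circ> s) j) i) \<longlonglongrightarrow> (L(Suc n := l)) i" if "i \<le> Suc n" for i
    proof (cases "i = Suc n")
      case True
      then show ?thesis using l by simp
    next
      case False
      then show ?thesis
        using that LIMSEQ_subseq_LIMSEQ[OF L[of i] s] by (simp add: o_def)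
    qed
    then show ?case
      using strict_mono_o[OF r s] by blast
  qed
qed

lemma IVT_sign_change:
  fixes f :: "real \<Rightarrow> real"
  assumes "x < y" "continuous_on {x..y} f" "f x * f y < 0"
  obtains z where "x < z" "z < y" "f z = 0"
proof -
  have "\<exists>z\<ge>x. z \<le> y \<and> f z = 0"
  proof (cases "f x < 0")
    case True
    with assms(3) have "f y > 0" by (simp add: mult_less_0_iff)
    then show ?thesis
      using IVT'[of f x 0 y] assms True by auto
  next
    case False
    with assms(3) have "f x > 0" "f y < 0" by (auto simp: mult_less_0_iff)
    then show ?thesis
      using IVT2'[of f y 0 x] assms by auto
  qed
  then obtain z where z: "x \<le> z" "z \<le> y" "f z = 0" by blast
  with assms(3) have "z \<noteq> x" "z \<noteq> y" by auto
  with z show ?thesis using that by force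
qed

lemma lin_comb_linear:
  "lin_comb n g (\<lambda>i. c * A i + d * B i) x = c * lin_comb n g A x + d * lin_comb n g B x"
  by (simp add: lin_comb_def sum.distrib sum_distrib_left algebra_simps)

subsection \<open>Zeros and sign patterns in a Chebyshev system\<close>

locale chebyshev_on =
  fixes a b :: real and n :: nat and g :: "nat \<Rightarrow> real \<Rightarrow> real"
  assumes less: "a < b"
    and continuous_g: "\<And>i. i \<in> {0..n} \<Longrightarrow> continuous_on {a..b} (g i)"
    and chebyshev: "chebyshev_system n g a b"
begin

lemma continuous_lin_comb: "K \<subseteq> {a..b} \<Longrightarrow> continuous_on K (lin_comb n g A)"
  unfolding lin_comb_def
  by (rule continuous_on_subset[of "{a..b}"]) (auto intro!: continuous_intros continuous_g)

text \<open>\<open>D\<close> is the inverse of the collocation matrix. Being a left inverse makes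
  its rows the cardinal combinations at the nodes; being a right inverse lets coefficients be read
  off from nodal values.\<close>

lemma dual_basis:
  assumes "strict_mono_on {1..n+1} t" "\<And>j. j \<in> {1..n+1} \<Longrightarrow> t j \<in> {a..b}"
  obtains D :: "nat \<Rightarrow> nat \<Rightarrow> real" where
    "\<And>j k. j \<le> n \<Longrightarrow> k \<le> n \<Longrightarrow> lin_comb n g (D j) (t (Suc k)) = (if j = k then 1 else 0)"
    "\<And>i k. i \<le> n \<Longrightarrow> k \<le> n \<Longrightarrow> (\<Sum>j=0..n. g i (t (Suc j)) * D j k) = (if i = k then 1 else 0)"
proof -
  define M where "M = Matrix.mat (n+1) (n+1) (\<lambda>(i, j). g i (t (j+1)))"
  have M: "M \<in> carrier_mat (n+1) (n+1)" by (simp add: M_def)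
  have "Determinant.det M \<noteq> 0"
    using chebyshev assms by (auto simp: chebyshev_system_def M_def)
  then have "M \<in> Units (ring_mat TYPE(real) (n+1) ())"
    by (rule det_non_zero_imp_unit[OF M])
  then obtain N where N: "N \<in> carrier_mat (n+1) (n+1)" "N * M = 1\<^sub>m (n+1)" "M * N = 1\<^sub>m (n+1)"
    by (auto simp: Units_def ring_mat_def)
  show ?thesis
  proof (rule that[of "\<lambda>j i. N $$ (j, i)"])
    fix j k assume jk: "j \<le> n" "k \<le> n"
    then have "(N * M) $$ (j, k) = (\<Sum>i=0..n. N $$ (j, i) * g i (t (Suc k)))"
      using N(1) by (auto simp: M_def scalar_prod_def atLeastLessThanSuc_atLeastAtMost intro!: sum.cong)
    then show "lin_comb n g (\<lambda>i. N $$ (j, i)) (t (Suc k)) = (if j = k then 1 else 0)"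
      using jk N(2) by (simp add: lin_comb_def)
  next
    fix i k assume ik: "i \<le> n" "k \<le> n"
    then have "(M * N) $$ (i, k) = (\<Sum>j=0..n. g i (t (Suc j)) * N $$ (j, k))"
      using N(1) by (auto simp: M_def scalar_prod_def atLeastLessThanSuc_atLeastAtMost intro!: sum.cong)
    then show "(\<Sum>j=0..n. g i (t (Suc j)) * N $$ (j, k)) = (if i = k then 1 else 0)"
      using ik N(3) by simp
  qed
qed

text \<open>The values at the nodes are the coefficient row times the collocation matrix, so
  multiplying by the inverse recovers the coefficients.\<close>

lemma vanishing_coefficients:
  assumes "strict_mono_on {1..n+1} t" "\<And>j. j \<in> {1..n+1} \<Longrightarrow> t j \<in> {a..b}"
    and zero: "\<And>j. j \<in> {1..n+1} \<Longrightarrow> lin_comb n g A (t j) = 0" and "k \<le> n"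
  shows "A k = 0"
proof -
  obtain D :: "nat \<Rightarrow> nat \<Rightarrow> real" where D:
    "\<And>i k. i \<le> n \<Longrightarrow> k \<le> n \<Longrightarrow> (\<Sum>j=0..n. g i (t (Suc j)) * D j k) = (if i = k then 1 else 0)"
    using dual_basis[OF assms(1,2)] by metis
  have "A k = (\<Sum>i=0..n. A i * (if i = k then 1 else 0))"
    using \<open>k \<le> n\<close> by (simp add: if_distrib cong: if_cong)
  also have "\<dots> = (\<Sum>i=0..n. A i * (\<Sum>j=0..n. g i (t (Suc j)) * D j k))"
    using \<open>k \<le> n\<close> by (intro sum.cong) (simp_all add: D)
  also have "\<dots> = (\<Sum>i=0..n. \<Sum>j=0..n. A i * g i (t (Suc j)) * D j k)"
    by (simp add: sum_distrib_left mult.assoc)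
  also have "\<dots> = (\<Sum>j=0..n. \<Sum>i=0..n. A i * g i (t (Suc j)) * D j k)"
    by (rule sum.swap)
  also have "\<dots> = (\<Sum>j=0..n. lin_comb n g A (t (Suc j)) * D j k)"
    by (simp add: lin_comb_def sum_distrib_right)
  also have "\<dots> = 0"
    using zero by (intro sum.neutral) auto
  finally show ?thesis .
qed

lemma vanishing_coefficients_set:
  assumes "finite Z" "Z \<subseteq> {a..b}" "card Z > n" "\<And>z. z \<in> Z \<Longrightarrow> lin_comb n g A z = 0" "k \<le> n"
  shows "A k = 0"
proof -
  obtain Y where Y: "Y \<subseteq> Z" "card Y = n+1"
    using obtain_subset_with_card_n[of "n+1" Z] assms(3) by auto
  with assms(1) have "finite Y" using finite_subset by blast
  then obtain t where t: "strict_mono_on {1..n+1} t" "t ` {1..n+1} = Y"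
    using strict_mono_enumeration_real Y(2) by metis
  show ?thesis
    using vanishing_coefficients[OF t(1), of A k] t(2) Y(1) assms by blast
qed

text \<open>After padding \<open>Z\<close> to \<open>n + 1\<close> nodes, the cardinal combinations
  are weighted by the values of \<open>y\<close>; at the padding nodes any value will do.\<close>

lemma interpolation:
  assumes "finite Z" "Z \<subseteq> {a..b}" "card Z \<le> n + 1"
  obtains A where "\<And>z. z \<in> Z \<Longrightarrow> lin_comb n g A z = y z"
proof -
  obtain Y where Y: "finite Y" "Z \<subseteq> Y" "Y - Z \<subseteq> {a<..<b}" "card Y = n + 1"
    using extend_node_set[OF assms(1,3) less] .
  then have "Y \<subseteq> {a..b}" using assms(2) by fastforce
  obtain t where t: "strict_mono_on {1..n+1} t" "t ` {1..n+1} = Y"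
    using strict_mono_enumeration_real[OF Y(1)] Y(4) by metis
  have "t j \<in> {a..b}" if "j \<in> {1..n+1}" for j
    using t(2) that \<open>Y \<subseteq> {a..b}\<close> by blast
  then obtain D :: "nat \<Rightarrow> nat \<Rightarrow> real" where D:
    "\<And>j k. j \<le> n \<Longrightarrow> k \<le> n \<Longrightarrow> lin_comb n g (D j) (t (Suc k)) = (if j = k then 1 else 0)"
    using dual_basis[OF t(1)] by metis
  define A where "A i = (\<Sum>j=0..n. y (t (Suc j)) * D j i)" for i
  have "lin_comb n g A (t (Suc k)) = y (t (Suc k))" if "k \<le> n" for k
  proof -
    have "lin_comb n g A (t (Suc k))
        = (\<Sum>i=0..n. \<Sum>j=0..n. y (t (Suc j)) * (D j i * g i (t (Suc k))))"
      by (simp add: lin_comb_def A_def sum_distrib_right mult.assoc)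
    also have "\<dots> = (\<Sum>j=0..n. \<Sum>i=0..n. y (t (Suc j)) * (D j i * g i (t (Suc k))))"
      by (rule sum.swap)
    also have "\<dots> = (\<Sum>j=0..n. y (t (Suc j)) * lin_comb n g (D j) (t (Suc k)))"
      by (simp add: lin_comb_def sum_distrib_left)
    also have "\<dots> = (\<Sum>j=0..n. y (t (Suc j)) * (if j = k then 1 else 0))"
      using that by (intro sum.cong) (simp_all add: D)
    also have "\<dots> = y (t (Suc k))"
      using that by (simp add: if_distrib cong: if_cong)
    finally show ?thesis .
  qed
  moreover have "\<exists>k\<le>n. z = t (Suc k)" if "z \<in> Z" for z
  proof -
    from that have "z \<in> t ` {1..n+1}" using t(2) Y(2) by blast
    then obtain j where "j \<in> {1..n+1}" "z = t j" by blast
    then show ?thesis by (intro exI[of _ "j - 1"]) auto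
  qed
  ultimately show ?thesis
    using that by metis
qed

section \<open>Number of zeros and changes of sign\<close>

lemma finite_zeros:
  assumes "k \<le> n" "A k \<noteq> 0"
  shows "finite {x\<in>{a..b}. lin_comb n g A x = 0}" "card {x\<in>{a..b}. lin_comb n g A x = 0} \<le> n"
proof -
  let ?Z = "{x\<in>{a..b}. lin_comb n g A x = 0}"
  have *: "card Y \<le> n" if "finite Y" "Y \<subseteq> ?Z" for Y
    using vanishing_coefficients_set[of Y A k] that assms by (force simp: not_less)
  show "finite ?Z"
  proof (rule ccontr)
    assume "infinite ?Z"
    then obtain Y where "finite Y" "card Y = Suc n" "Y \<subseteq> ?Z"
      using infinite_arbitrarily_large by blast
    with * show False by force
  qed
  then show "card ?Z \<le> n" using * by blast
qed

text \<open>If the sign did not change at \<open>z\<close>, subtracting a small combination that equals the sign at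
  \<open>z\<close> and vanishes at the other zeros would split \<open>z\<close> into two zeros, giving \<open>n + 1\<close> in total.\<close>

lemma sign_change_at_zero:
  assumes Z: "finite Z" "Z \<subseteq> {a..b}" "card Z = n"
    and zeros: "\<And>x. x \<in> {a..b} \<Longrightarrow> lin_comb n g A x = 0 \<longleftrightarrow> x \<in> Z"
    and uv: "a \<le> u" "u < z" "z < v" "v \<le> b" and only: "Z \<inter> {u..v} = {z}"
  shows "lin_comb n g A u * lin_comb n g A v < 0"
proof (rule ccontr)
  let ?p = "lin_comb n g A"
  assume "\<not> ?p u * ?p v < 0"
  moreover have "z \<in> Z" "u \<notin> Z" "v \<notin> Z"
    using only uv by auto
  then have nz: "?p u \<noteq> 0" "?p v \<noteq> 0" using zeros[of u] zeros[of v] uv by auto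
  ultimately have same: "?p u * ?p v > 0"
    by (simp add: not_less order_less_le)
  define s where "s = sgn (?p u)"
  have s: "s * ?p u = \<bar>?p u\<bar>" "s * ?p v = \<bar>?p v\<bar>" "s * s = 1" "\<bar>s\<bar> = 1"
    using same by (auto simp: s_def sgn_if zero_less_mult_iff)
  obtain Q where Q: "\<And>x. x \<in> Z \<Longrightarrow> lin_comb n g Q x = (if x = z then s else 0)"
    using interpolation[OF Z(1,2), of "\<lambda>x. if x = z then s else 0"] Z(3) by auto
  let ?q = "lin_comb n g Q"
  \<comment> \<open>Small enough that subtracting \<open>e * ?q\<close> cannot reverse the sign of
    \<open>?p\<close> at \<open>u\<close> and \<open>v\<close>; the added 1 avoids division by
    zero.\<close>
  define e where "e = min (\<bar>?p u\<bar> / (\<bar>?q u\<bar> + 1)) (\<bar>?p v\<bar> / (\<bar>?q v\<bar> + 1))"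
  have "e > 0" using nz by (simp add: e_def)
  have small: "e * \<bar>?q x\<bar> < \<bar>?p x\<bar>" if "x = u \<or> x = v" for x
  proof -
    have "e \<le> \<bar>?p x\<bar> / (\<bar>?q x\<bar> + 1)" using that by (auto simp: e_def)
    then have "e * (\<bar>?q x\<bar> + 1) \<le> \<bar>?p x\<bar>" by (simp add: pos_le_divide_eq)
    with \<open>e > 0\<close> show ?thesis by (simp add: algebra_simps)
  qed
  define R where "R i = 1 * A i + (- e) * Q i" for i
  let ?r = "lin_comb n g R"
  have r: "?r x = ?p x - e * ?q x" for x
    unfolding R_def by (subst lin_comb_linear) simp
  have rz: "?r z = - e * s"
    using Q[OF \<open>z \<in> Z\<close>] zeros[of z] \<open>z \<in> Z\<close> Z(2) by (auto simp: r)
  have pos: "s * ?r x > 0" if "x = u \<or> x = v" for x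
  proof -
    have "s * ?q x \<le> \<bar>?q x\<bar>"
      using abs_ge_self[of "s * ?q x"] by (simp add: abs_mult s(4))
    then have "e * (s * ?q x) \<le> e * \<bar>?q x\<bar>" using \<open>e > 0\<close> by simp
    with small[OF that] have "e * (s * ?q x) < \<bar>?p x\<bar>" by linarith
    moreover have "s * ?r x = \<bar>?p x\<bar> - e * (s * ?q x)"
      using s that by (auto simp: r algebra_simps)
    ultimately show ?thesis by simp
  qed
  have neg: "?r x * ?r z < 0" if "x = u \<or> x = v" for x
    using mult_pos_pos[OF \<open>e > 0\<close> pos[OF that]] by (simp add: rz algebra_simps)
  obtain z1 where z1: "u < z1" "z1 < z" "?r z1 = 0"
    using IVT_sign_change[of u z ?r] neg[of u] uv continuous_lin_comb[of "{u..z}" R] by auto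
  obtain z2 where z2: "z < z2" "z2 < v" "?r z2 = 0"
    using IVT_sign_change[of z v ?r] neg[of v] uv continuous_lin_comb[of "{z..v}" R]
    by (auto simp: mult.commute)
  \<comment> \<open>The zero \<open>z\<close> is traded for \<open>z1\<close> and \<open>z2\<close>;
    the other points of \<open>Z\<close> remain zeros because \<open>?q\<close> vanishes
    there.\<close>
  let ?W = "insert z1 (insert z2 (Z - {z}))"
  have "z1 \<notin> Z" "z2 \<notin> Z" using only z1 z2 uv by auto
  then have "card ?W > n"
    using Z \<open>z \<in> Z\<close> z1 z2 card_Suc_Diff1[OF Z(1) \<open>z \<in> Z\<close>] by simp
  moreover have "?W \<subseteq> {a..b}" using Z(2) z1 z2 uv by auto
  moreover have "?r x = 0" if "x \<in> ?W" for x
    using that z1 z2 Q[of x] zeros[of x] Z(2) by (auto simp: r)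
  ultimately have "R k = 0" if "k \<le> n" for k
    using vanishing_coefficients_set[of ?W R k] Z(1) that by blast
  then have "?r z = 0" by (simp add: lin_comb_def)
  with rz \<open>e > 0\<close> s(4) show False by auto
qed

text \<open>Induction on the number of zeros in between, removing the largest one: each zero
  contributes one factor -1 by \<open>sign_change_at_zero\<close>.\<close>

lemma sign_between_nonzeros:
  assumes Z: "finite Z" "Z \<subseteq> {a..b}" "card Z = n"
    and zeros: "\<And>x. x \<in> {a..b} \<Longrightarrow> lin_comb n g A x = 0 \<longleftrightarrow> x \<in> Z"
    and "a \<le> x" "x < y" "y \<le> b" "x \<notin> Z" "y \<notin> Z"
  shows "(-1) ^ card (Z \<inter> {x..y}) * (lin_comb n g A x * lin_comb n g A y) > 0"
  using assms(6,7,9)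
proof (induction "card (Z \<inter> {x..y})" arbitrary: y)
  let ?p = "lin_comb n g A"
  case 0
  then have empty: "Z \<inter> {x..y} = {}" using Z(1) by auto
  have "\<not> ?p x * ?p y < 0"
  proof
    assume "?p x * ?p y < 0"
    then obtain z where "x < z" "z < y" "?p z = 0"
      using IVT_sign_change[of x y ?p] 0 \<open>a \<le> x\<close> continuous_lin_comb[of "{x..y}" A] by auto
    with empty zeros[of z] 0 \<open>a \<le> x\<close> show False by auto
  qed
  moreover have "?p x \<noteq> 0" "?p y \<noteq> 0"
    using zeros[of x] zeros[of y] 0 assms(5,8) by auto
  ultimately show ?case
    using empty by (simp add: not_less order_less_le)
next
  let ?p = "lin_comb n g A"
  case (Suc c)
  define z where "z = Max (Z \<inter> {x..y})"
  have fin: "finite (Z \<inter> {x..y})" and "Z \<inter> {x..y} \<noteq> {}"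
    using Z(1) Suc(2) by auto
  then have "z \<in> Z \<inter> {x..y}" and z_max: "\<And>w. w \<in> Z \<inter> {x..y} \<Longrightarrow> w \<le> z"
    using Max_in[of "Z \<inter> {x..y}"] by (auto simp: z_def)
  with assms(8) Suc.prems have z: "z \<in> Z" "x < z" "z < y"
    by (auto simp: order_less_le)
  \<comment> \<open>\<open>w\<close> is the last zero before \<open>z\<close>, or \<open>x\<close>
    if there is none, so the midpoint \<open>y'\<close> of \<open>w\<close> and \<open>z\<close>
    separates \<open>z\<close> from the earlier zeros.\<close>
  define w where "w = Max (insert x (Z \<inter> {x..<z}))"
  have "w \<in> insert x (Z \<inter> {x..<z})" and w_max: "\<And>v. v \<in> Z \<inter> {x..<z} \<Longrightarrow> v \<le> w" and "x \<le> w"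
    using Max_in[of "insert x (Z \<inter> {x..<z})"] Z(1) by (auto simp: w_def)
  with z have "w < z" by auto
  define y' where "y' = (w + z) / 2"
  have y': "w < y'" "y' < z" using \<open>w < z\<close> by (auto simp: y'_def)
  have "y' \<notin> Z" using w_max[of y'] y' \<open>x \<le> w\<close> by auto
  have eq: "Z \<inter> {x..y'} = Z \<inter> {x..y} - {z}"
    using z_max w_max y' z by (force simp: not_le order_less_le)
  have "c = card (Z \<inter> {x..y'})"
    using Suc(2) \<open>z \<in> Z \<inter> {x..y}\<close> fin by (simp add: eq)
  moreover have "x < y'" "y' \<le> b" using y' \<open>x \<le> w\<close> z Suc.prems by auto
  ultimately have IH: "(-1) ^ c * (?p x * ?p y') > 0"
    using Suc(1)[of y'] \<open>y' \<notin> Z\<close> by simp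
  have "Z \<inter> {y'..y} = {z}"
    using z_max w_max y' z \<open>x < y'\<close> by (force simp: not_le order_less_le)
  then have "?p y' * ?p y < 0"
    using sign_change_at_zero[OF Z zeros, of y' z y] y' z Suc.prems \<open>x < y'\<close> \<open>a \<le> x\<close> by auto
  from mult_pos_neg[OF IH this]
  have "((-1) ^ c * (?p x * ?p y)) * (?p y')\<^sup>2 < 0"
    by (simp add: power2_eq_square algebra_simps)
  then have "(-1) ^ c * (?p x * ?p y) < 0"
    by (simp add: mult_less_0_iff)
  then show ?case by (simp flip: Suc(2))
qed

text \<open>Vanishing on \<open>Z\<close> and having the right sign at one further point are
  \<open>n + 1\<close> interpolation conditions. A nontrivial combination has at most
  \<open>n\<close> zeros, so \<open>Z\<close> is the entire zero set and the sign spreads from that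
  point by parity.\<close>

lemma exact_sign_pattern:
  assumes Z: "finite Z" "Z \<subseteq> {a..b}" "card Z = n"
  obtains A where "\<And>z. z \<in> Z \<Longrightarrow> lin_comb n g A z = 0"
    "\<And>x. x \<in> {a..b} - Z \<Longrightarrow> (-1) ^ card {z\<in>Z. z < x} * lin_comb n g A x > 0"
proof -
  have "infinite ({a..b} - Z)"
    by (rule Diff_infinite_finite[OF Z(1) infinite_Icc[OF less]])
  then obtain x0 where x0: "x0 \<in> {a..b}" "x0 \<notin> Z"
    using infinite_imp_nonempty[of "{a..b} - Z"] by blast
  define c where "c x = card {z\<in>Z. z < x}" for x
  obtain A where A: "\<And>x. x \<in> insert x0 Z \<Longrightarrow> lin_comb n g A x = (if x = x0 then (-1) ^ c x0 else 0)"
    using interpolation[of "insert x0 Z" "\<lambda>x. if x = x0 then (-1) ^ c x0 else 0"] Z x0 by auto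
  let ?p = "lin_comb n g A"
  have p0: "?p x0 = (-1) ^ c x0" using A by simp
  then have "?p x0 \<noteq> 0" by simp
  then obtain k where k: "k \<le> n" "A k \<noteq> 0"
    by (force simp: lin_comb_def intro: ccontr sum.neutral)
  have sub: "Z \<subseteq> {x\<in>{a..b}. ?p x = 0}" using A Z(2) x0 by auto
  have "Z = {x\<in>{a..b}. ?p x = 0}"
    using finite_zeros[of k A] k Z(3) sub by (intro card_seteq) auto
  then have zeros: "?p x = 0 \<longleftrightarrow> x \<in> Z" if "x \<in> {a..b}" for x using that by auto
  show ?thesis
  proof (rule that[of A])
    show "?p z = 0" if "z \<in> Z" for z using that sub by auto
    fix x assume x: "x \<in> {a..b} - Z"
    consider "x = x0" | "x0 < x" | "x < x0" by linarith
    then have "(-1) ^ c x * ?p x > 0"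
    proof cases
      case 1
      then show ?thesis by (simp add: p0 flip: power_add)
    next
      case 2
      then have "c x = c x0 + card (Z \<inter> {x0..x})"
        using card_less_split[OF Z(1) 2] x x0 by (simp add: c_def)
      then show ?thesis
        using sign_between_nonzeros[OF Z zeros, of x0 x] 2 x x0 by (simp add: p0 power_add algebra_simps)
    next
      case 3
      then have "c x0 = c x + card (Z \<inter> {x..x0})"
        using card_less_split[OF Z(1) 3] x x0 by (simp add: c_def)
      moreover have "(-1::real) ^ k * (-1) ^ k = 1" for k by (simp flip: power_add)
      ultimately show ?thesis
        using sign_between_nonzeros[OF Z zeros, of x x0] 3 x x0
        by (simp add: p0 power_add algebra_simps)
    qed
    then show "(-1) ^ card {z\<in>Z. z < x} * ?p x > 0" by (simp add: c_def)
  qed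
qed

text \<open>The missing zeros are clustered at \<open>b\<close>, where the cluster disappears in the limit.\<close>

lemma weak_sign_pattern:
  assumes Z: "finite Z" "Z \<subseteq> {a..b}" "card Z \<le> n"
  obtains A k where "k \<le> n" "A k \<noteq> 0" "\<And>z. z \<in> Z \<Longrightarrow> lin_comb n g A z = 0"
    "\<And>x. x \<in> {a..b} \<Longrightarrow> (-1) ^ card {z\<in>Z. z < x} * lin_comb n g A x \<ge> 0"
proof -
  \<comment> \<open>The last node before \<open>b\<close>, or \<open>a\<close> if there is none: to
    the right of \<open>c\<close> only \<open>b\<close> can belong to \<open>Z\<close>, so the count
    of nodes below \<open>x\<close> is constant there.\<close>
  define c where "c = Max (insert a (Z - {b}))"
  have "c \<in> insert a (Z - {b})" and c_max: "\<And>z. z \<in> Z - {b} \<Longrightarrow> z \<le> c" and "a \<le> c"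
    using Max_in[of "insert a (Z - {b})"] Z(1) by (auto simp: c_def)
  then have "c < b" using Z(2) less by fastforce
  \<comment> \<open>Increases from \<open>c\<close> towards \<open>b\<close> without reaching it;
    the filler zeros of stage \<open>j\<close> lie beyond \<open>d j\<close>.\<close>
  define d where "d j = b - (b - c) * inverse (real (Suc j))" for j
  have d: "c \<le> d j" "d j < b" for j
  proof -
    have "inverse (real (Suc j)) \<le> 1" by (simp add: field_simps)
    then have "(b - c) * inverse (real (Suc j)) \<le> (b - c) * 1"
      using \<open>c < b\<close> by (intro mult_left_mono) auto
    then show "c \<le> d j" by (simp add: d_def)
    show "d j < b" using \<open>c < b\<close> by (simp add: d_def)
  qed
  have d_lim: "d \<longlonglongrightarrow> b"
  proof -
    have "(\<lambda>j. b - (b - c) * inverse (real (Suc j))) \<longlonglongrightarrow> b - (b - c) * 0"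
      by (intro tendsto_intros LIMSEQ_inverse_real_of_nat)
    then show ?thesis unfolding d_def by simp
  qed
  define s where "s x = (-1::real) ^ card {z\<in>Z. z < x}" for x
  \<comment> \<open>Normalising the coefficients to absolute sum 1 provides the bounds for a
    convergent subsequence and keeps its limit from being zero.\<close>
  have "\<exists>A. (\<Sum>i=0..n. \<bar>A i\<bar>) = 1 \<and> (\<forall>z\<in>Z. lin_comb n g A z = 0) \<and>
          (\<forall>x\<in>{a..d j}. s x * lin_comb n g A x \<ge> 0)" for j
  proof -
    obtain Y where Y: "finite Y" "Z \<subseteq> Y" "Y - Z \<subseteq> {d j<..<b}" "card Y = n"
      using extend_node_set[OF Z(1,3) d(2)] .
    have "Y \<subseteq> {a..b}" using Y(3) Z(2) d[of j] \<open>a \<le> c\<close> by fastforce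
    obtain A where A: "\<And>z. z \<in> Y \<Longrightarrow> lin_comb n g A z = 0"
      "\<And>x. x \<in> {a..b} - Y \<Longrightarrow> (-1) ^ card {z\<in>Y. z < x} * lin_comb n g A x > 0"
      using exact_sign_pattern[OF Y(1) \<open>Y \<subseteq> {a..b}\<close> Y(4)] by metis
    define N where "N = (\<Sum>i=0..n. \<bar>A i\<bar>)"
    have "infinite ({a..b} - Y)"
      by (rule Diff_infinite_finite[OF Y(1) infinite_Icc[OF less]])
    then obtain x0 where "x0 \<in> {a..b} - Y"
      using infinite_imp_nonempty[of "{a..b} - Y"] by blast
    with A(2)[of x0] have "lin_comb n g A x0 \<noteq> 0" by auto
    then obtain k where "k \<le> n" "A k \<noteq> 0"
      by (force simp: lin_comb_def intro: ccontr sum.neutral)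
    then have "N > 0" unfolding N_def by (intro sum_pos2[of _ k]) auto
    have scale: "lin_comb n g (\<lambda>i. A i / N) x = lin_comb n g A x / N" for x
      by (simp add: lin_comb_def sum_divide_distrib)
    have "(\<Sum>i=0..n. \<bar>A i / N\<bar>) = 1"
      using \<open>N > 0\<close> by (simp add: N_def flip: sum_divide_distrib)
    moreover have "s x * lin_comb n g A x \<ge> 0" if x: "x \<in> {a..d j}" for x
    proof (cases "x \<in> Y")
      case True
      then show ?thesis by (simp add: A(1))
    next
      case False
      have "{z\<in>Y. z < x} = {z\<in>Z. z < x}" using Y(2,3) x by auto
      then show ?thesis
        using A(2)[of x] False x d(2)[of j] by (simp add: s_def)
    qed
    ultimately show ?thesis
      using A(1) Y(2) \<open>N > 0\<close>
      by (intro exI[of _ "\<lambda>i. A i / N"]) (auto simp: scale)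
  qed
  then obtain A where A: "\<And>j. (\<Sum>i=0..n. \<bar>A j i\<bar>) = 1" "\<And>j z. z \<in> Z \<Longrightarrow> lin_comb n g (A j) z = 0"
    "\<And>j x. x \<in> {a..d j} \<Longrightarrow> s x * lin_comb n g (A j) x \<ge> 0"
    by metis
  have "\<bar>A j i\<bar> \<le> 1" if "i \<le> n" for i j
  proof -
    have "\<bar>A j i\<bar> \<le> (\<Sum>i=0..n. \<bar>A j i\<bar>)" using that by (intro member_le_sum) auto
    then show ?thesis by (simp add: A(1))
  qed
  then obtain r L where r: "strict_mono (r :: nat \<Rightarrow> nat)"
    and L: "\<And>i. i \<le> n \<Longrightarrow> (\<lambda>j. A (r j) i) \<longlonglongrightarrow> L i"
    using bounded_sequences_convergent_subseq[of n A 1] by metis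
  have p_lim: "(\<lambda>j. lin_comb n g (A (r j)) x) \<longlonglongrightarrow> lin_comb n g L x" for x
    unfolding lin_comb_def using L by (intro tendsto_intros) auto
  have "(\<lambda>j. \<Sum>i=0..n. \<bar>A (r j) i\<bar>) \<longlonglongrightarrow> (\<Sum>i=0..n. \<bar>L i\<bar>)"
    using L by (intro tendsto_intros) auto
  then have "(\<Sum>i=0..n. \<bar>L i\<bar>) = 1"
    by (simp add: A(1) LIMSEQ_const_iff)
  then obtain k where k: "k \<le> n" "L k \<noteq> 0"
    by (metis (no_types, lifting) abs_zero atLeastAtMost_iff sum.neutral zero_neq_one)
  have zero: "lin_comb n g L z = 0" if "z \<in> Z" for z
    using p_lim[of z] by (simp add: A(2)[OF that] LIMSEQ_const_iff)
  have below: "s x * lin_comb n g L x \<ge> 0" if x: "a \<le> x" "x < b" for x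
  proof (rule tendsto_lowerbound)
    show "(\<lambda>j. s x * lin_comb n g (A (r j)) x) \<longlonglongrightarrow> s x * lin_comb n g L x"
      by (intro tendsto_intros p_lim)
    have "\<forall>\<^sub>F j in sequentially. x < d (r j)"
      using order_tendstoD(1)[OF LIMSEQ_subseq_LIMSEQ[OF d_lim r] x(2)] by (simp add: o_def)
    then show "\<forall>\<^sub>F j in sequentially. 0 \<le> s x * lin_comb n g (A (r j)) x"
      by eventually_elim (use A(3) x in auto)
  qed simp
  \<comment> \<open>No \<open>d j\<close> reaches \<open>b\<close>, so the sign there comes from the
    left limit, the node count being constant just below \<open>b\<close>.\<close>
  have "s b * lin_comb n g L b \<ge> 0"
  proof (rule tendsto_lowerbound)
    have "(lin_comb n g L \<longlongrightarrow> lin_comb n g L b) (at b within {a..b})"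
      using continuous_lin_comb[of "{a..b}" L] less by (auto simp: continuous_on_def)
    then have "(lin_comb n g L \<longlongrightarrow> lin_comb n g L b) (at_left b)"
      using at_within_Icc_at_left[OF less] by simp
    then show "((\<lambda>x. s b * lin_comb n g L x) \<longlongrightarrow> s b * lin_comb n g L b) (at_left b)"
      by (intro tendsto_intros)
    have "\<forall>\<^sub>F x in at_left b. c < x \<and> x < b"
      using eventually_at_left_field \<open>c < b\<close> by blast
    then show "\<forall>\<^sub>F x in at_left b. 0 \<le> s b * lin_comb n g L x"
    proof eventually_elim
      case (elim x)
      then have "{z\<in>Z. z < b} = {z\<in>Z. z < x}" using c_max by force
      then show ?case using below[of x] elim \<open>a \<le> c\<close> by (simp add: s_def)
    qed
  qed simp
  with below have "s x * lin_comb n g L x \<ge> 0" if "x \<in> {a..b}" for x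
    using that by (cases "x = b") auto
  with k zero show ?thesis
    using that[of k L] by (simp add: s_def)
qed

text \<open>The weak signs can fail to be strict only at the at most \<open>n\<close> zeros of
  \<open>A\<close>, where \<open>Q\<close> is free to prescribe them. A large multiple of
  \<open>A\<close> plus \<open>Q\<close> is, up to scaling, a small perturbation of
  \<open>A\<close>.\<close>

lemma strict_separation:
  assumes "compact E" "compact F" "E \<inter> F = {}" "E \<subseteq> {a..b}" "F \<subseteq> {a..b}"
    and A: "k \<le> n" "A k \<noteq> 0"
    and E: "\<And>x. x \<in> E \<Longrightarrow> lin_comb n g A x \<ge> 0" and F: "\<And>x. x \<in> F \<Longrightarrow> lin_comb n g A x \<le> 0"
  obtains B where "\<And>x. x \<in> E \<Longrightarrow> lin_comb n g B x > 0" "\<And>x. x \<in> F \<Longrightarrow> lin_comb n g B x < 0"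
proof -
  let ?p = "lin_comb n g A" and ?Z = "{x\<in>{a..b}. lin_comb n g A x = 0}"
  \<comment> \<open>The value -1 at zeros outside \<open>E\<close> covers those in \<open>F\<close>,
    since the two sets are disjoint.\<close>
  obtain Q where Q: "\<And>x. x \<in> ?Z \<Longrightarrow> lin_comb n g Q x = (if x \<in> E then 1 else -1)"
  proof (rule interpolation[of ?Z "\<lambda>x. if x \<in> E then 1 else -1"])
    show "finite ?Z" "card ?Z \<le> n + 1" using finite_zeros[of k A] A by auto
  qed auto
  let ?q = "lin_comb n g Q"
  have "\<forall>\<^sub>F c in at_top. \<forall>x\<in>E. 0 < c * ?p x + ?q x"
    using assms Q by (intro eventually_scaled_sum_pos continuous_lin_comb) auto
  moreover have "\<forall>\<^sub>F c in at_top. \<forall>x\<in>F. 0 < c * (- ?p x) + (- ?q x)"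
  proof (intro eventually_scaled_sum_pos continuous_on_minus continuous_lin_comb)
    fix x assume "x \<in> F" "- ?p x = 0"
    moreover from this have "x \<in> ?Z" "x \<notin> E" using assms(3,5) by auto
    ultimately show "0 < - ?q x" using Q[of x] by simp
  qed (use assms in auto)
  ultimately have "\<forall>\<^sub>F c in at_top. (\<forall>x\<in>E. 0 < c * ?p x + ?q x) \<and> (\<forall>x\<in>F. 0 < c * (- ?p x) + (- ?q x))"
    by (rule eventually_conj)
  then obtain c where c: "\<forall>x\<in>E. 0 < c * ?p x + ?q x" "\<forall>x\<in>F. 0 < c * (- ?p x) + (- ?q x)"
    using eventually_happens'[OF trivial_limit_at_top_linorder] by blast
  have "lin_comb n g (\<lambda>i. c * A i + 1 * Q i) x = c * ?p x + ?q x" for x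
    by (subst lin_comb_linear) simp
  then show ?thesis
    using that[of "\<lambda>i. c * A i + 1 * Q i"] c by fastforce
qed

end

subsection \<open>Alternation and separation\<close>

text \<open>The first set always receives the odd indices, so the two kinds of alternation differ
  only by exchanging the sets.\<close>

definition alternates :: "real set \<Rightarrow> real set \<Rightarrow> nat \<Rightarrow> (nat \<Rightarrow> real) \<Rightarrow> bool" where
  "alternates E F N t \<longleftrightarrow> strict_mono_on {1..N} t \<and>
     (\<forall>k\<in>{1..N}. (odd k \<longrightarrow> t k \<in> E) \<and> (even k \<longrightarrow> t k \<in> F))"

text \<open>Shifting indices by one flips their parity, which is why the two sets exchange roles.
  That \<open>x\<close> lies below \<open>F\<close> puts it before the old first point.\<close>

lemma alternates_prepend:
  assumes "alternates F E N t" "x \<in> E" "\<And>y. y \<in> F \<Longrightarrow> x < y"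
  shows "\<exists>t. alternates E F (Suc N) t"
proof -
  let ?t = "\<lambda>k. if k = 1 then x else t (k - 1)"
  have t: "strict_mono_on {1..N} t" "\<And>k. k \<in> {1..N} \<Longrightarrow> odd k \<Longrightarrow> t k \<in> F"
    "\<And>k. k \<in> {1..N} \<Longrightarrow> even k \<Longrightarrow> t k \<in> E"
    using assms(1) by (auto simp: alternates_def)
  have "strict_mono_on {1..Suc N} ?t"
  proof (rule strict_mono_onI_Suc)
    fix k assume "1 \<le> k" "k < Suc N"
    then show "?t k < ?t (Suc k)"
      using t(2)[of 1] assms(3) strict_mono_onD[OF t(1), of "k - 1" k] by (cases "k = 1") force+
  qed
  moreover have "(odd k \<longrightarrow> ?t k \<in> E) \<and> (even k \<longrightarrow> ?t k \<in> F)" if "k \<in> {1..Suc N}" for k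
  proof (cases "k = 1")
    case True
    then show ?thesis using assms(2) by simp
  next
    case False
    then have "k - 1 \<in> {1..N}" using that by auto
    then show ?thesis using t(2,3)[of "k - 1"] False by auto
  qed
  ultimately have "alternates E F (Suc N) ?t" by (simp add: alternates_def)
  then show ?thesis by blast
qed

lemma alternates_mono:
  "alternates E F N t \<Longrightarrow> E \<subseteq> E' \<Longrightarrow> F \<subseteq> F' \<Longrightarrow> alternates E' F' N t"
  by (auto simp: alternates_def)

text \<open>\<open>Z\<close> consists of the successive points at which the set being visited switches, starting
  with the first point of \<open>E\<close>. Points of \<open>Z\<close> itself are counted, since each belongs to
  the set visited after the switch.\<close>

lemma switching_points:
  assumes "compact E" "compact F" "E \<inter> F = {}" "\<nexists>t. alternates E F (Suc N) t"
  shows "\<exists>Z. finite Z \<and> card Z \<le> N \<and> Z \<subseteq> E \<union> F \<and>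
    (\<forall>x\<in>E. odd (card {z\<in>Z. z \<le> x})) \<and> (\<forall>x\<in>F. even (card {z\<in>Z. z \<le> x}))"
  using assms
proof (induction N arbitrary: E F)
  case 0
  have "E = {}"
  proof (rule ccontr)
    assume "E \<noteq> {}"
    then obtain x where "x \<in> E" by blast
    then have "alternates E F (Suc 0) (\<lambda>_. x)"
      by (auto simp: alternates_def strict_mono_on_def)
    with 0(4) show False by blast
  qed
  then show ?case by (intro exI[of _ "{}"]) auto
next
  case (Suc N)
  show ?case
  proof (cases "E = {}")
    case True
    then show ?thesis by (intro exI[of _ "{}"]) auto
  next
    case False
    \<comment> \<open>The first point of \<open>E\<close> is the first switch; points of
      \<open>F\<close> before it have count 0.\<close>
    obtain x0 where x0: "x0 \<in> E" "\<forall>y\<in>E. x0 \<le> y"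
      using compact_attains_inf[OF Suc.prems(1) False] by blast
    let ?F = "F \<inter> {x0..}"
    have F_gt: "x0 < y" if "y \<in> ?F" for y
      using that x0(1) Suc.prems(3) by (cases "y = x0") auto
    \<comment> \<open>Beyond \<open>x0\<close> the next switch is into \<open>F\<close>: the
      induction applies with the sets exchanged and one point fewer.\<close>
    have "\<nexists>t. alternates ?F E (Suc N) t"
    proof
      assume "\<exists>t. alternates ?F E (Suc N) t"
      then obtain t where "alternates ?F E (Suc N) t" by blast
      from alternates_prepend[OF this x0(1) F_gt] Suc.prems(4) show False
        using alternates_mono[of E ?F _ _ E F] by blast
    qed
    moreover have "compact ?F"
      using Suc.prems(2) by (intro compact_Int_closed) auto
    ultimately obtain Z where Z: "finite Z" "card Z \<le> N" "Z \<subseteq> ?F \<union> E"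
      "\<forall>x\<in>?F. odd (card {z\<in>Z. z \<le> x})" "\<forall>x\<in>E. even (card {z\<in>Z. z \<le> x})"
      using Suc.IH[of ?F E] Suc.prems(1,3) by blast
    have Z_ge: "z \<ge> x0" if "z \<in> Z" for z using that Z(3) x0(2) by auto
    have "x0 \<notin> Z"
    proof
      assume "x0 \<in> Z"
      with Z_ge have "{z\<in>Z. z \<le> x0} = {x0}" by force
      then show False using Z(5) x0(1) by auto
    qed
    \<comment> \<open>The extra point \<open>x0\<close> flips every parity from \<open>x0\<close>
      on, undoing the exchange of the sets.\<close>
    have count: "card {z\<in>insert x0 Z. z \<le> x} = Suc (card {z\<in>Z. z \<le> x})" if "x0 \<le> x" for x
    proof -
      have "{z\<in>insert x0 Z. z \<le> x} = insert x0 {z\<in>Z. z \<le> x}" using that by auto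
      then show ?thesis using Z(1) \<open>x0 \<notin> Z\<close> by simp
    qed
    have count0: "{z\<in>insert x0 Z. z \<le> x} = {}" if "x < x0" for x
      using that Z_ge by force
    show ?thesis
    proof (intro exI[of _ "insert x0 Z"] conjI ballI)
      show "card (insert x0 Z) \<le> Suc N" using Z(1,2) \<open>x0 \<notin> Z\<close> by simp
      show "insert x0 Z \<subseteq> E \<union> F" using Z(3) x0(1) by auto
      show "odd (card {z\<in>insert x0 Z. z \<le> x})" if "x \<in> E" for x
        using count[of x] x0(2) Z(5) that by auto
      show "even (card {z\<in>insert x0 Z. z \<le> x})" if "x \<in> F" for x
      proof (cases "x0 \<le> x")
        case True
        then show ?thesis using count[of x] Z(4) that by auto
      next
        case False
        then show ?thesis using count0[of x] by (simp only: not_le) simp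
      qed
    qed (use Z(1) in auto)
  qed
qed

section \<open>Separation of two disjoint compact sets by a combination\<close>

context chebyshev_on
begin

text \<open>Switches are counted from the first point of \<open>F\<close>, so an even count means
  the sign wanted on \<open>E\<close> and an odd count the sign wanted on \<open>F\<close>.
  Excluding \<open>n + 1\<close> alternating points leaves at most \<open>n\<close> switches, few
  enough zeros for \<open>weak_sign_pattern\<close>.\<close>

lemma separation_if_no_alternation:
  assumes EF: "compact E" "compact F" "E \<inter> F = {}" "E \<subseteq> {a..b}" "F \<subseteq> {a..b}"
    and no: "\<nexists>t. alternates F E (Suc n) t"
  obtains B where "\<And>x. x \<in> E \<Longrightarrow> lin_comb n g B x > 0" "\<And>x. x \<in> F \<Longrightarrow> lin_comb n g B x < 0"
proof -
  obtain Z where Z: "finite Z" "card Z \<le> n" "Z \<subseteq> F \<union> E"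
    "\<forall>x\<in>F. odd (card {z\<in>Z. z \<le> x})" "\<forall>x\<in>E. even (card {z\<in>Z. z \<le> x})"
    using switching_points[of F E n] EF no by (auto simp: Int_commute)
  have "Z \<subseteq> {a..b}" using Z(3) EF by blast
  obtain A k where A: "k \<le> n" "A k \<noteq> 0" "\<And>z. z \<in> Z \<Longrightarrow> lin_comb n g A z = 0"
    "\<And>x. x \<in> {a..b} \<Longrightarrow> (-1) ^ card {z\<in>Z. z < x} * lin_comb n g A x \<ge> 0"
    using weak_sign_pattern[OF Z(1) \<open>Z \<subseteq> {a..b}\<close> Z(2)] by metis
  \<comment> \<open>Counting nodes up to \<open>x\<close> inclusively or strictly differs only for
    \<open>x\<close> in \<open>Z\<close>, where the combination vanishes.\<close>
  have sign: "(-1) ^ card {z\<in>Z. z \<le> x} * lin_comb n g A x \<ge> 0" if "x \<in> {a..b}" for x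
  proof (cases "x \<in> Z")
    case True
    then show ?thesis by (simp add: A(3))
  next
    case False
    then have "{z\<in>Z. z \<le> x} = {z\<in>Z. z < x}" by (auto simp: order_less_le)
    then show ?thesis using A(4)[OF that] by simp
  qed
  have "lin_comb n g A x \<ge> 0" if "x \<in> E" for x
    using sign[of x] Z(5) EF(4) that by auto
  moreover have "lin_comb n g A x \<le> 0" if "x \<in> F" for x
    using sign[of x] Z(4) EF(5) that by auto
  ultimately show ?thesis
    using strict_separation[OF EF, of k A] A(1,2) that by blast
qed

text \<open>The leftmost point of the union could be prepended to an alternation of
  \<open>n + 1\<close> points starting in the other set, so none exists and
  \<open>separation_if_no_alternation\<close> applies with the sets in the matching order.\<close>

lemma separation_or_alternation:
  assumes EF: "compact E" "compact F" "E \<inter> F = {}" "E \<subseteq> {a..b}" "F \<subseteq> {a..b}" "E \<union> F \<noteq> {}"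
    and no: "\<nexists>t. alternates E F (n+2) t" "\<nexists>t. alternates F E (n+2) t"
  obtains B where "\<And>x. x \<in> E \<Longrightarrow> lin_comb n g B x > 0" "\<And>x. x \<in> F \<Longrightarrow> lin_comb n g B x < 0"
proof -
  obtain x0 where x0: "x0 \<in> E \<union> F" "\<forall>y\<in>E \<union> F. x0 \<le> y"
    using compact_attains_inf[OF compact_Un[OF EF(1,2)] EF(6)] by blast
  show ?thesis
  proof (cases "x0 \<in> E")
    case True
    then have "x0 < y" if "y \<in> F" for y
      using that x0(2) EF(3) by (cases "y = x0") (auto simp: order_less_le)
    then have "\<nexists>t. alternates F E (Suc n) t"
      using alternates_prepend[of F E "Suc n" _ x0] True no(1) by auto
    then show ?thesis
      using separation_if_no_alternation[OF EF(1-5)] that by metis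
  next
    case False
    then have "x0 \<in> F" using x0(1) by blast
    then have "x0 < y" if "y \<in> E" for y
      using that x0(2) EF(3) by (cases "y = x0") (auto simp: order_less_le)
    then have "\<nexists>t. alternates E F (Suc n) t"
      using alternates_prepend[of E F "Suc n" _ x0] \<open>x0 \<in> F\<close> no(2) by auto
    moreover have "F \<inter> E = {}" using EF(3) by blast
    ultimately obtain B where B: "\<And>x. x \<in> F \<Longrightarrow> lin_comb n g B x > 0"
      "\<And>x. x \<in> E \<Longrightarrow> lin_comb n g B x < 0"
      using separation_if_no_alternation[OF EF(2,1) _ EF(5,4)] by metis
    have "lin_comb n g (\<lambda>i. - B i) x = - lin_comb n g B x" for x
      by (simp add: lin_comb_def sum_negf)
    then show ?thesis using that[of "\<lambda>i. - B i"] B by auto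
  qed
qed

text \<open>Strict sign changes in all \<open>n + 1\<close> gaps would yield \<open>n + 1\<close>
  zeros, forcing all coefficients and hence the values at the nodes to vanish.\<close>

lemma no_alternating_signs:
  assumes t: "strict_mono_on {1..n+2} t" "\<And>k. k \<in> {1..n+2} \<Longrightarrow> t k \<in> {a..b}"
  shows "\<exists>k\<in>{1..n+1}. lin_comb n g A (t k) * lin_comb n g A (t (Suc k)) \<ge> 0"
proof (rule ccontr)
  let ?p = "lin_comb n g A"
  assume "\<not> ?thesis"
  then have neg: "?p (t k) * ?p (t (Suc k)) < 0" if "k \<in> {1..n+1}" for k
    using that by (auto simp: not_le)
  have "\<exists>z. t k < z \<and> z < t (Suc k) \<and> ?p z = 0" if k: "k \<in> {1..n+1}" for k
  proof -
    have "t k < t (Suc k)" using strict_mono_onD[OF t(1), of k "Suc k"] k by auto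
    moreover have "{t k..t (Suc k)} \<subseteq> {a..b}" using t(2)[of k] t(2)[of "Suc k"] k by auto
    ultimately show ?thesis
      using IVT_sign_change[of "t k" "t (Suc k)" ?p] neg[OF k] continuous_lin_comb by metis
  qed
  then obtain z where z: "\<And>k. k \<in> {1..n+1} \<Longrightarrow> t k < z k \<and> z k < t (Suc k) \<and> ?p (z k) = 0"
    by metis
  have "strict_mono_on {1..n+1} z"
  proof (rule strict_mono_onI_Suc)
    fix k assume "1 \<le> k" "k < n+1"
    then show "z k < z (Suc k)" using z[of k] z[of "Suc k"] by auto
  qed
  moreover have "z k \<in> {a..b}" if "k \<in> {1..n+1}" for k
    using z[OF that] t(2)[of k] t(2)[of "Suc k"] that by auto
  ultimately have "A i = 0" if "i \<le> n" for i
    using vanishing_coefficients[of z A i] z that by blast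
  then have "?p (t 1) = 0" by (simp add: lin_comb_def)
  with neg[of 1] show False by simp
qed

end

subsection \<open>Approximation of a pair of curves\<close>

locale curve_pair = chebyshev_on +
  fixes m :: nat and S :: "nat \<Rightarrow> real \<Rightarrow> real"
  assumes m: "m \<ge> 1"
    and continuous_S: "\<And>i. i \<in> {1..m} \<Longrightarrow> continuous_on {a..b} (S i)"
begin

abbreviation "dev A \<equiv> max_deviation a b m S n g A"

abbreviation "positive_points A \<equiv> {t. pos_max_dev_point a b m S n g A t}"

abbreviation "negative_points A \<equiv> {t. neg_max_dev_point a b m S n g A t}"

lemma continuous_S_max_min: "continuous_on {a..b} (S_max m S)" "continuous_on {a..b} (S_min m S)"
  unfolding S_max_def S_min_def using m continuous_S
  by (auto intro!: continuous_on_Max_image continuous_on_Min_image)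

section \<open>Maximal deviation and its points\<close>

lemma max_deviation_at:
  obtains t where "t \<in> {a..b}"
    "dev A = max (S_max m S t - lin_comb n g A t) (lin_comb n g A t - S_min m S t)"
  using max_deviation_attained[of a b m n g S A] less m continuous_g continuous_S by auto

lemma deviation_le:
  assumes "t \<in> {a..b}"
  shows "S_max m S t - lin_comb n g A t \<le> dev A" "lin_comb n g A t - S_min m S t \<le> dev A"
  using max_deviation_attained[of a b m n g S A] less m continuous_g continuous_S assms by fastforce+

lemma compact_positive_points: "compact (positive_points A)"
proof -
  \<comment> \<open>As \<open>dev A\<close> bounds the deviation, equality can be replaced by an
    inequality, a closed condition.\<close>
  have "positive_points A = {t\<in>{a..b}. dev A \<le> S_max m S t - lin_comb n g A t}"
    using deviation_le by (auto simp: pos_max_dev_point_def intro: antisym)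
  moreover have "closed \<dots>"
    by (intro continuous_on_closed_Collect_le continuous_intros continuous_S_max_min
        continuous_lin_comb) auto
  ultimately have "closed (positive_points A)" by simp
  then have "compact ({a..b} \<inter> positive_points A)" by (intro compact_Int_closed) auto
  also have "{a..b} \<inter> positive_points A = positive_points A"
    by (auto simp: pos_max_dev_point_def)
  finally show ?thesis .
qed

lemma compact_negative_points: "compact (negative_points A)"
proof -
  have "negative_points A = {t\<in>{a..b}. dev A \<le> lin_comb n g A t - S_min m S t}"
    using deviation_le by (auto simp: neg_max_dev_point_def intro: antisym)
  moreover have "closed \<dots>"
    by (intro continuous_on_closed_Collect_le continuous_intros continuous_S_max_min
        continuous_lin_comb) auto
  ultimately have "closed (negative_points A)" by simp
  then have "compact ({a..b} \<inter> negative_points A)" by (intro compact_Int_closed) auto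
  also have "{a..b} \<inter> negative_points A = negative_points A"
    by (auto simp: neg_max_dev_point_def)
  finally show ?thesis .
qed

text \<open>The slack below \<open>dev A\<close> vanishes exactly at the maximal deviation points,
  where \<open>B\<close> has the sign that helps. Hence a large multiple \<open>c\<close> of the
  slack plus the helpful change is positive everywhere, on both sides at once.\<close>

lemma descent:
  assumes pos: "\<And>t. t \<in> positive_points A \<Longrightarrow> lin_comb n g B t > 0"
    and neg: "\<And>t. t \<in> negative_points A \<Longrightarrow> lin_comb n g B t < 0"
  shows "\<exists>C. dev C < dev A"
proof -
  let ?p = "lin_comb n g B"
  have "\<forall>\<^sub>F c in at_top. \<forall>t\<in>{a..b}. 0 < c * (dev A - (S_max m S t - lin_comb n g A t)) + ?p t"
  proof (rule eventually_scaled_sum_pos)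
    fix t assume t: "t \<in> {a..b}"
    show "0 \<le> dev A - (S_max m S t - lin_comb n g A t)" using deviation_le[OF t] by simp
    assume "dev A - (S_max m S t - lin_comb n g A t) = 0"
    then show "0 < ?p t" using pos t by (simp add: pos_max_dev_point_def)
  qed (auto intro!: continuous_intros continuous_S_max_min continuous_lin_comb)
  moreover have "\<forall>\<^sub>F c in at_top.
    \<forall>t\<in>{a..b}. 0 < c * (dev A - (lin_comb n g A t - S_min m S t)) + (- ?p t)"
  proof (rule eventually_scaled_sum_pos)
    fix t assume t: "t \<in> {a..b}"
    show "0 \<le> dev A - (lin_comb n g A t - S_min m S t)" using deviation_le[OF t] by simp
    assume "dev A - (lin_comb n g A t - S_min m S t) = 0"
    then show "0 < - ?p t" using neg t by (simp add: neg_max_dev_point_def)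
  qed (auto intro!: continuous_intros continuous_S_max_min continuous_lin_comb)
  moreover have "\<forall>\<^sub>F c :: real in at_top. c > 0" by (rule eventually_gt_at_top)
  ultimately have "\<forall>\<^sub>F c in at_top. c > 0 \<and>
      (\<forall>t\<in>{a..b}. 0 < c * (dev A - (S_max m S t - lin_comb n g A t)) + ?p t) \<and>
      (\<forall>t\<in>{a..b}. 0 < c * (dev A - (lin_comb n g A t - S_min m S t)) + (- ?p t))"
    by (intro eventually_conj)
  then obtain c where c: "c > 0"
    "\<And>t. t \<in> {a..b} \<Longrightarrow> 0 < c * (dev A - (S_max m S t - lin_comb n g A t)) + ?p t"
    "\<And>t. t \<in> {a..b} \<Longrightarrow> 0 < c * (dev A - (lin_comb n g A t - S_min m S t)) + (- ?p t)"
    using eventually_happens'[OF trivial_limit_at_top_linorder] by blast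
  \<comment> \<open>Dividing by \<open>c\<close> turns the weight on the slack into the step length
    \<open>1 / c\<close> along \<open>B\<close>.\<close>
  define C where "C i = 1 * A i + (1 / c) * B i" for i
  have C: "lin_comb n g C t = lin_comb n g A t + ?p t / c" for t
    unfolding C_def by (subst lin_comb_linear) simp
  \<comment> \<open>The maximum is attained, so strict inequalities at that point alone give a
    strictly smaller deviation.\<close>
  obtain t where t: "t \<in> {a..b}"
    "dev C = max (S_max m S t - lin_comb n g C t) (lin_comb n g C t - S_min m S t)"
    using max_deviation_at[of C] .
  have "S_max m S t - lin_comb n g C t < dev A" "lin_comb n g C t - S_min m S t < dev A"
    using c(2,3)[OF t(1)] c(1) by (simp_all add: C field_simps)
  then show ?thesis by (intro exI[of _ C]) (simp add: t(2))
qed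

text \<open>The two deviations at \<open>t\<close> sum to \<open>S_max m S t - S_min m S t\<close>
  for every coefficient vector; for \<open>A\<close> this is \<open>2 * dev A\<close>, for
  \<open>B\<close> it is at most \<open>2 * dev B\<close>.\<close>

lemma best_if_midpoint:
  assumes "t \<in> {a..b}" "dev A = S_max m S t - lin_comb n g A t" "dev A = lin_comb n g A t - S_min m S t"
  shows "dev A \<le> dev B"
  using deviation_le[OF assms(1), of B] assms(2,3) by linarith

text \<open>If \<open>B\<close> were strictly better, \<open>B - A\<close> would be positive at
  positive and negative at negative maximal deviation points, giving too many sign changes. Stating
  the alternation by consecutive pairs covers both orders at once.\<close>

lemma best_if_alternation:
  assumes t: "strict_mono_on {1..n+2} t"
    and alt: "\<And>k. k \<in> {1..n+1} \<Longrightarrow>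
      t k \<in> positive_points A \<and> t (Suc k) \<in> negative_points A \<or>
      t k \<in> negative_points A \<and> t (Suc k) \<in> positive_points A"
  shows "dev A \<le> dev B"
proof (rule ccontr)
  assume "\<not> dev A \<le> dev B"
  define D where "D i = 1 * B i + (-1) * A i" for i
  have D: "lin_comb n g D x = lin_comb n g B x - lin_comb n g A x" for x
    unfolding D_def by (subst lin_comb_linear) simp
  have pos: "lin_comb n g D x > 0" if "x \<in> positive_points A" for x
    using that deviation_le[of x B] \<open>\<not> dev A \<le> dev B\<close> by (auto simp: D pos_max_dev_point_def)
  have neg: "lin_comb n g D x < 0" if "x \<in> negative_points A" for x
    using that deviation_le[of x B] \<open>\<not> dev A \<le> dev B\<close> by (auto simp: D neg_max_dev_point_def)
  have "t k \<in> {a..b}" if k: "k \<in> {1..n+2}" for k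
  proof (cases "k = n+2")
    case True
    then show ?thesis
      using alt[of "n+1"] by (auto simp: pos_max_dev_point_def neg_max_dev_point_def)
  next
    case False
    then show ?thesis
      using alt[of k] k by (auto simp: pos_max_dev_point_def neg_max_dev_point_def)
  qed
  then obtain k where k: "k \<in> {1..n+1}" "lin_comb n g D (t k) * lin_comb n g D (t (Suc k)) \<ge> 0"
    using no_alternating_signs[OF t] by blast
  show False
    using alt[OF k(1)] pos neg k(2) mult_pos_neg mult_neg_pos by (metis not_le)
qed

lemma midpoint_or_alternation_if_best:
  assumes best: "\<And>B. dev A \<le> dev B"
  shows "(\<exists>t\<in>{a..b}. dev A = S_max m S t - lin_comb n g A t \<and> dev A = lin_comb n g A t - S_min m S t) \<or>
    (\<exists>t. alternates (positive_points A) (negative_points A) (n+2) t) \<or>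
    (\<exists>t. alternates (negative_points A) (positive_points A) (n+2) t)"
proof (rule ccontr)
  assume "\<not> ?thesis"
  then have no: "\<not> (\<exists>t\<in>{a..b}. dev A = S_max m S t - lin_comb n g A t \<and>
      dev A = lin_comb n g A t - S_min m S t)"
    and no_alt: "\<nexists>t. alternates (positive_points A) (negative_points A) (n+2) t"
      "\<nexists>t. alternates (negative_points A) (positive_points A) (n+2) t"
    by auto
  have disj: "positive_points A \<inter> negative_points A = {}"
    using no unfolding pos_max_dev_point_def neg_max_dev_point_def disjoint_iff mem_Collect_eq by metis
  have sub: "positive_points A \<subseteq> {a..b}" "negative_points A \<subseteq> {a..b}"
    by (auto simp: pos_max_dev_point_def neg_max_dev_point_def)
  \<comment> \<open>A maximiser is a point of one kind or the other, so the union has a leftmost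
    point.\<close>
  obtain t where "t \<in> {a..b}"
    "dev A = max (S_max m S t - lin_comb n g A t) (lin_comb n g A t - S_min m S t)"
    using max_deviation_at[of A] .
  then have "t \<in> positive_points A \<union> negative_points A"
    by (simp add: pos_max_dev_point_def neg_max_dev_point_def max_def split: if_splits)
  then have nonempty: "positive_points A \<union> negative_points A \<noteq> {}" by blast
  obtain B where "\<And>t. t \<in> positive_points A \<Longrightarrow> lin_comb n g B t > 0"
    "\<And>t. t \<in> negative_points A \<Longrightarrow> lin_comb n g B t < 0"
    using separation_or_alternation[OF compact_positive_points compact_negative_points
        disj sub nonempty no_alt] by blast
  then have "\<exists>C. dev C < dev A" by (rule descent)
  with best show False by (auto simp: not_le[symmetric])
qed

end

theorem theorem3p2:
  fixes a b \<Delta> :: real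
    and n m :: nat
    and g S :: "nat \<Rightarrow> real \<Rightarrow> real"
    and A :: "nat \<Rightarrow> real"
  assumes "a < b"
    and "\<And>i. i \<in> {0..n} \<Longrightarrow> continuous_on {a..b} (g i)"
    and "chebyshev_system n g a b"
    and "m \<ge> 1"
    and "\<And>i. i \<in> {1..m} \<Longrightarrow> continuous_on {a..b} (S i)"
    and "\<Delta> = max_deviation a b m S n g A"
  shows "best_approximation a b m S n g A \<longleftrightarrow>
    (\<exists>\<tau>\<in>{a..b}. \<Delta> = S_max m S \<tau> - lin_comb n g A \<tau> \<and> \<Delta> = lin_comb n g A \<tau> - S_min m S \<tau>) \<or>
    (\<exists>t :: nat \<Rightarrow> real. strict_mono_on {1..n+2} t \<and> (\<forall>k\<in>{1..n+2}. t k \<in> {a..b}) \<and>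
       ((\<forall>k\<in>{1..n+2}. (odd k \<longrightarrow> pos_max_dev_point a b m S n g A (t k)) \<and>
                       (even k \<longrightarrow> neg_max_dev_point a b m S n g A (t k))) \<or>
        (\<forall>k\<in>{1..n+2}. (odd k \<longrightarrow> neg_max_dev_point a b m S n g A (t k)) \<and>
                       (even k \<longrightarrow> pos_max_dev_point a b m S n g A (t k)))))"
    (is "_ \<longleftrightarrow> ?mid \<or> ?alt")
proof -
  interpret curve_pair a b n g m S
    using assms(1-5) by unfold_locales
  have alt_iff: "?alt \<longleftrightarrow>
    (\<exists>t. alternates (positive_points A) (negative_points A) (n+2) t) \<or>
    (\<exists>t. alternates (negative_points A) (positive_points A) (n+2) t)" (is "_ \<longleftrightarrow> ?alt'")
  proof
    assume ?alt
    then obtain t where "alternates (positive_points A) (negative_points A) (n+2) t \<or>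
        alternates (negative_points A) (positive_points A) (n+2) t"
      unfolding alternates_def mem_Collect_eq by metis
    then show ?alt' by metis
  next
    assume ?alt'
    then obtain t where t: "alternates (positive_points A) (negative_points A) (n+2) t \<or>
        alternates (negative_points A) (positive_points A) (n+2) t" by blast
    \<comment> \<open>Membership in the interval is recovered from the points themselves, as both
      kinds lie in it by definition.\<close>
    have "t k \<in> {a..b}" if "k \<in> {1..n+2}" for k
    proof -
      have "t k \<in> positive_points A \<union> negative_points A"
        using t that by (cases "odd k") (auto simp: alternates_def)
      then show ?thesis by (auto simp: pos_max_dev_point_def neg_max_dev_point_def)
    qed
    with t show ?alt
      unfolding alternates_def mem_Collect_eq by (intro exI[of _ t]) metis
  qed
  show ?thesis
  proof
    assume "best_approximation a b m S n g A"
    then show "?mid \<or> ?alt"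
      unfolding alt_iff assms(6) best_approximation_def
      by (intro midpoint_or_alternation_if_best) blast
  next
    assume "?mid \<or> ?alt"
    then consider ?mid | t where "alternates (positive_points A) (negative_points A) (n+2) t \<or>
        alternates (negative_points A) (positive_points A) (n+2) t"
      unfolding alt_iff by blast
    then have "dev A \<le> dev B" for B
    proof cases
      case 1
      then obtain \<tau> where "\<tau> \<in> {a..b}" "dev A = S_max m S \<tau> - lin_comb n g A \<tau>"
        "dev A = lin_comb n g A \<tau> - S_min m S \<tau>"
        using assms(6) by auto
      then show ?thesis by (rule best_if_midpoint)
    next
      case 2
      have "t k \<in> positive_points A \<and> t (Suc k) \<in> negative_points A \<or>
        t k \<in> negative_points A \<and> t (Suc k) \<in> positive_points A" if "k \<in> {1..n+1}" for k
      proof -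
        have "k \<in> {1..n+2}" "Suc k \<in> {1..n+2}" using that by auto
        with 2 show ?thesis unfolding alternates_def by (metis even_Suc)
      qed
      moreover have "strict_mono_on {1..n+2} t" using 2 by (auto simp: alternates_def)
      ultimately show ?thesis by (intro best_if_alternation)
    qed
    then show "best_approximation a b m S n g A" by (simp add: best_approximation_def)
  qed
qed

end
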